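(* Let $(M,\mu)$ be a complete metric space and let $V$ and $W$ be two non-empty closed and convex subsets of $M$ such that $V\cap W\neq\varnothing$. Let $f,g:V\cup W\to V\cup W$ be two continuous co-cyclic mappings, that is, $f(V)\subseteq g(V)\subseteq W$ and $f(W)\subseteq g(W)\subseteq V$. Suppose that there exists $q\in(0,1)$ such that $$\mu(f(x),f(y))\leq q\,\mu(g(x),g(y))\qquad\text{for all } x\in V \text{ and all } y\in W.$$ If $f$ and $g$ are compatible, then $f$ and $g$ have a unique common fixed point in $V\cap W$; that is, there is exactly one $z\in V\cap W$ with $f(z)=g(z)=z$.
   Context: Compatibility: two self-mappings $f,g:X\to X$ of a metric space $(X,\mu)$ are called compatible if $\lim_{n\to\infty}\mu\bigl(f(g(x_n)),g(f(x_n))\bigr)=0$ whenever $\{x_n\}$ is a sequence in $X$ such that $\lim_{n\to\infty}f(x_n)$ and $\lim_{n\to\infty}g(x_n)$ exist in $X$ and are equal. Here it is applied with $X=V\cup W$ equipped with the restriction of $\mu$. Convexity: a subset $C$ of a metric space $(M,\mu)$ is convex (in the metric sense) if for every two distinct points $x,y\in C$ there is a point $z\in C$ with $z\neq x$, $z\neq y$ and $\mu(x,z)+\mu(z,y)=\mu(x,y)$. *)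

theory Defs
  imports Complex_Main
begin

text \<open>Convexity in the metric (Menger) sense, with the intermediate point required to lie in
  the set itself; it is unrelated to linear convexity.\<close>

definition metric_convex :: "'a::metric_space set \<Rightarrow> bool" where
  "metric_convex C \<longleftrightarrow>
     (\<forall>x\<in>C. \<forall>y\<in>C. x \<noteq> y \<longrightarrow>
        (\<exists>z\<in>C. z \<noteq> x \<and> z \<noteq> y \<and> dist x z + dist z y = dist x y))"

text \<open>Self-mappings of a subset \<open>X\<close> are total functions of which only the values on \<open>X\<close> matter.
  The common limit must lie in \<open>X\<close>, since \<open>X\<close> is regarded as a metric space of its own.\<close>

definition compatible_on ::
    "'a::metric_space set \<Rightarrow> ('a \<Rightarrow> 'a) \<Rightarrow> ('a \<Rightarrow> 'a) \<Rightarrow> bool" where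
  "compatible_on X f g \<longleftrightarrow>
     (\<forall>x :: nat \<Rightarrow> 'a.
        (\<forall>n. x n \<in> X) \<and>
        (\<exists>l\<in>X. (\<lambda>n. f (x n)) \<longlonglongrightarrow> l \<and> (\<lambda>n. g (x n)) \<longlonglongrightarrow> l) \<longrightarrow>
        (\<lambda>n. dist (f (g (x n))) (g (f (x n)))) \<longlonglongrightarrow> 0)"

definition co_cyclic :: "'a set \<Rightarrow> 'a set \<Rightarrow> ('a \<Rightarrow> 'a) \<Rightarrow> ('a \<Rightarrow> 'a) \<Rightarrow> bool" where
  "co_cyclic V W f g \<longleftrightarrow>
     f ` V \<subseteq> g ` V \<and> g ` V \<subseteq> W \<and> f ` W \<subseteq> g ` W \<and> g ` W \<subseteq> V"

end

theory Submission
  imports Defs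
begin

text \<open>
  This is Jungck's common fixed point argument run simultaneously in \<open>V\<close> and in \<open>W\<close>.
  From a common starting point in \<open>V \<inter> W\<close>, the inclusions \<open>f ` V \<subseteq> g ` V\<close> and
  \<open>f ` W \<subseteq> g ` W\<close> give one sequence \<open>x\<close> in \<open>V\<close> and one sequence \<open>y\<close> in \<open>W\<close>, each
  satisfying \<open>g (x (Suc n)) = f (x n)\<close> (\<open>jungck_sequence\<close>). The contraction condition
  compares only points of \<open>V\<close> with points of \<open>W\<close>, but it shows by induction that the two
  sequences have the same images under \<open>f\<close>, because they start with equal images. The
  common sequence of images \<open>u\<close> can therefore be read as an image of \<open>V\<close> or of \<open>W\<close> at
  will. This has two effects: \<open>u\<close> lies in \<open>W \<inter> V\<close>, and the contraction condition bounds
  the distance between any two of its terms, so that \<open>u\<close> is a Cauchy sequence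
  (\<open>Cauchy_if_shift_contracts\<close>).

  Let \<open>z\<close> be the limit of \<open>u\<close>, which lies in \<open>V \<inter> W\<close> by closedness. Both \<open>f (x n)\<close> and
  \<open>g (x n)\<close> tend to \<open>z\<close>, so compatibility and continuity give \<open>f z = g z\<close>. Comparing \<open>z\<close>
  with \<open>y n\<close> and passing to the limit gives \<open>dist (f z) z \<le> q * dist (g z) z\<close>, hence
  \<open>f z = z\<close>. Uniqueness is immediate from the contraction condition.
\<close>

text \<open>The distances from the initial term stay bounded by \<open>dist (u 1) (u 0) / (1 - q)\<close>, the
  fixed point of the recursive bound \<open>t \<mapsto> q * t + dist (u 1) (u 0)\<close>; shifting both indices
  by \<open>m\<close> multiplies this bound by \<open>q ^ m\<close>.\<close>

lemma Cauchy_if_shift_contracts: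
  fixes u :: "nat \<Rightarrow> 'a::metric_space" and q :: real
  assumes q: "0 \<le> q" "q < 1"
    and contr: "\<And>m n. dist (u (Suc m)) (u (Suc n)) \<le> q * dist (u m) (u n)"
  shows "Cauchy u"
proof -
  define B where "B = dist (u 1) (u 0) / (1 - q)"
  have B: "q * B + dist (u 1) (u 0) = B"
    using q by (simp add: B_def field_simps)
  have bounded: "dist (u k) (u 0) \<le> B" for k
  proof (induction k)
    case 0
    show ?case using q by (simp add: B_def)
  next
    case (Suc k)
    have "dist (u (Suc k)) (u 0) \<le> dist (u (Suc k)) (u 1) + dist (u 1) (u 0)"
      by (rule dist_triangle)
    also have "\<dots> \<le> q * dist (u k) (u 0) + dist (u 1) (u 0)"
      using contr[of k 0] by simp
    also have "\<dots> \<le> q * B + dist (u 1) (u 0)"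
      using Suc.IH q by (simp add: mult_left_mono)
    finally show ?case using B by simp
  qed
  have tail: "dist (u (m + k)) (u m) \<le> q ^ m * B" for m k
  proof (induction m)
    case 0
    show ?case using bounded by simp
  next
    case (Suc m)
    have "dist (u (Suc m + k)) (u (Suc m)) \<le> q * dist (u (m + k)) (u m)"
      using contr[of "m + k" m] by simp
    also have "\<dots> \<le> q * (q ^ m * B)"
      using Suc.IH q by (simp add: mult_left_mono)
    finally show ?case by simp
  qed
  have "(\<lambda>m. q ^ m * B) \<longlonglongrightarrow> 0"
    using q by (intro tendsto_mult_left_zero LIMSEQ_power_zero) simp
  show ?thesis
  proof (rule metric_CauchyI)
    fix e :: real
    assume "0 < e"
    then have "\<forall>\<^sub>F m in sequentially. q ^ m * B < e / 2"
      using \<open>(\<lambda>m. q ^ m * B) \<longlonglongrightarrow> 0\<close> by (intro order_tendstoD(2)) auto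
    then obtain M where M: "q ^ M * B < e / 2"
      by (auto simp: eventually_sequentially)
    have near: "dist (u n) (u M) < e / 2" if "M \<le> n" for n
      using tail[of M "n - M"] M that by simp
    have "dist (u m) (u n) < e" if "M \<le> m" "M \<le> n" for m n
      using near[OF that(1)] near[OF that(2)] dist_triangle2[of "u m" "u n" "u M"] by simp
    then show "\<exists>M. \<forall>m\<ge>M. \<forall>n\<ge>M. dist (u m) (u n) < e" by blast
  qed
qed

lemma jungck_sequence:
  assumes "f ` S \<subseteq> g ` S" and "a \<in> S"
  obtains x :: "nat \<Rightarrow> 'a"
  where "x 0 = a" and "\<And>n. x n \<in> S" and "\<And>n. g (x (Suc n)) = f (x n)"
proof -
  have "\<exists>x. \<forall>n. (x n \<in> S \<and> (n = 0 \<longrightarrow> x n = a)) \<and> g (x (Suc n)) = f (x n)"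
  proof (rule dependent_nat_choice)
    show "\<exists>b. b \<in> S \<and> (0 = (0::nat) \<longrightarrow> b = a)" using assms(2) by blast
  next
    fix b and n :: nat
    assume "b \<in> S \<and> (n = 0 \<longrightarrow> b = a)"
    then have "f b \<in> g ` S" using assms(1) by blast
    then show "\<exists>c. (c \<in> S \<and> (Suc n = 0 \<longrightarrow> c = a)) \<and> g c = f b" by auto
  qed
  with that show ?thesis by blast
qed

text \<open>Along a sequence witnessing compatibility, continuity identifies the limits of
  \<open>f (g (x n))\<close> and \<open>g (f (x n))\<close> as \<open>f z\<close> and \<open>g z\<close>.\<close>

lemma compatible_on_limit_coincidence:
  fixes X :: "'a::metric_space set"
  assumes comp: "compatible_on X f g"
    and cont: "continuous_on X f" "continuous_on X g"
    and maps: "f ` X \<subseteq> X" "g ` X \<subseteq> X"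
    and x: "\<And>n. x n \<in> X" and z: "z \<in> X"
    and lims: "(\<lambda>n. f (x n)) \<longlonglongrightarrow> z" "(\<lambda>n. g (x n)) \<longlonglongrightarrow> z"
  shows "f z = g z"
proof -
  have "(\<lambda>n. f (g (x n))) \<longlonglongrightarrow> f z"
    using maps x by (intro continuous_on_tendsto_compose[OF cont(1) lims(2) z] always_eventually) blast
  moreover have "(\<lambda>n. g (f (x n))) \<longlonglongrightarrow> g z"
    using maps x by (intro continuous_on_tendsto_compose[OF cont(2) lims(1) z] always_eventually) blast
  ultimately have "(\<lambda>n. dist (f (g (x n))) (g (f (x n)))) \<longlonglongrightarrow> dist (f z) (g z)"
    by (rule tendsto_dist)
  moreover have "(\<lambda>n. dist (f (g (x n))) (g (f (x n)))) \<longlonglongrightarrow> 0"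
    using comp x z lims unfolding compatible_on_def by blast
  ultimately have "dist (f z) (g z) = 0" by (rule LIMSEQ_unique)
  then show ?thesis by simp
qed

lemma eq_if_dist_le_contraction:
  fixes a b :: "'a::metric_space" and q :: real
  assumes "q < 1" and "dist a b \<le> q * dist a b"
  shows "a = b"
proof (rule ccontr)
  assume "a \<noteq> b"
  then have "q * dist a b < 1 * dist a b" using assms(1) by (intro mult_strict_right_mono) auto
  with assms(2) show False by simp
qed

theorem theorem2p9:
  fixes V W :: "'a::complete_space set" and f g :: "'a \<Rightarrow> 'a"
  assumes "V \<noteq> {}" and "W \<noteq> {}"
    and "closed V" and "closed W"
    and "metric_convex V" and "metric_convex W"
    and "V \<inter> W \<noteq> {}"
    and "f ` (V \<union> W) \<subseteq> V \<union> W" and "g ` (V \<union> W) \<subseteq> V \<union> W"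
    and "continuous_on (V \<union> W) f" and "continuous_on (V \<union> W) g"
    and "co_cyclic V W f g"
    and "\<exists>q::real. 0 < q \<and> q < 1 \<and>
           (\<forall>x\<in>V. \<forall>y\<in>W. dist (f x) (f y) \<le> q * dist (g x) (g y))"
    and "compatible_on (V \<union> W) f g"
  shows "\<exists>!z. z \<in> V \<inter> W \<and> f z = z \<and> g z = z"
proof -
  obtain q :: real where q: "0 < q" "q < 1"
    and contr: "\<And>x y. x \<in> V \<Longrightarrow> y \<in> W \<Longrightarrow> dist (f x) (f y) \<le> q * dist (g x) (g y)"
    using assms(13) by blast
  have fV: "f ` V \<subseteq> g ` V" and gV: "g ` V \<subseteq> W" and fW: "f ` W \<subseteq> g ` W" and gW: "g ` W \<subseteq> V"
    using assms(12) by (auto simp: co_cyclic_def)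
  obtain a where a: "a \<in> V" "a \<in> W" using assms(7) by blast
  obtain x where x0: "x 0 = a" and xV: "\<And>n. x n \<in> V" and gx: "\<And>n. g (x (Suc n)) = f (x n)"
    using jungck_sequence[OF fV a(1)] by blast
  obtain y where y0: "y 0 = a" and yW: "\<And>n. y n \<in> W" and gy: "\<And>n. g (y (Suc n)) = f (y n)"
    using jungck_sequence[OF fW a(2)] by blast
  have same: "f (y n) = f (x n)" for n
  proof (induction n)
    case 0
    show ?case by (simp add: x0 y0)
  next
    case (Suc n)
    have "dist (f (x (Suc n))) (f (y (Suc n))) \<le> q * dist (f (x n)) (f (y n))"
      using contr[OF xV yW, of "Suc n" "Suc n"] by (simp add: gx gy)
    then show ?case using Suc.IH by simp
  qed
  define u where "u n = f (x n)" for n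
  have uW: "u n \<in> W" for n
    unfolding u_def using fV gV xV by blast
  have uV: "u n \<in> V" for n
    unfolding u_def same[symmetric] using fW gW yW by blast
  have "dist (u (Suc m)) (u (Suc n)) \<le> q * dist (u m) (u n)" for m n
    using contr[OF xV yW, of "Suc m" "Suc n"] by (simp add: gx gy same u_def)
  then have "Cauchy u" using q by (intro Cauchy_if_shift_contracts[of q]) auto
  then obtain z where uz: "u \<longlonglongrightarrow> z"
    by (auto simp: Cauchy_convergent_iff convergent_def)
  have z: "z \<in> V" "z \<in> W"
    using Lim_in_closed_set[OF assms(3) _ _ uz] Lim_in_closed_set[OF assms(4) _ _ uz] uV uW
    by auto
  have fx: "(\<lambda>n. f (x n)) \<longlonglongrightarrow> z" using uz by (simp add: u_def[abs_def])
  have fy: "(\<lambda>n. f (y n)) \<longlonglongrightarrow> z" using fx by (simp add: same)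
  have gxz: "(\<lambda>n. g (x n)) \<longlonglongrightarrow> z"
    by (rule LIMSEQ_imp_Suc) (simp add: gx fx)
  have gyz: "(\<lambda>n. g (y n)) \<longlonglongrightarrow> z"
    by (rule LIMSEQ_imp_Suc) (simp add: gy fy)
  have fg: "f z = g z"
    using xV z(1)
    by (intro compatible_on_limit_coincidence[OF assms(14) assms(10,11) assms(8,9) _ _ fx gxz]) auto
  have "dist (f z) z \<le> q * dist (g z) z"
  proof (rule LIMSEQ_le)
    show "(\<lambda>n. dist (f z) (f (y n))) \<longlonglongrightarrow> dist (f z) z"
      by (intro tendsto_dist tendsto_const fy)
    show "(\<lambda>n. q * dist (g z) (g (y n))) \<longlonglongrightarrow> q * dist (g z) z"
      by (intro tendsto_mult tendsto_dist tendsto_const gyz)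
    show "\<exists>N. \<forall>n\<ge>N. dist (f z) (f (y n)) \<le> q * dist (g z) (g (y n))"
      using contr[OF z(1) yW] by blast
  qed
  then have fz: "f z = z"
    by (intro eq_if_dist_le_contraction[OF q(2)]) (simp add: fg)
  show ?thesis
  proof (rule ex1I)
    show "z \<in> V \<inter> W \<and> f z = z \<and> g z = z" using z fz fg by simp
  next
    fix w
    assume w: "w \<in> V \<inter> W \<and> f w = w \<and> g w = w"
    then have "dist w z \<le> q * dist w z"
      using contr[of w z] z fz fg by simp
    then show "w = z" by (rule eq_if_dist_le_contraction[OF q(2)])
  qed
qed

end
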